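(* Let $n,r$ be positive integers with $r$ odd, and let $G=K_{n,\ldots,n,n+1,n+1}$ be the complete $(r+1)$-partite graph with $r-1$ parts of size $n$ and two parts of size $n+1$. Then $\mathrm{def}(G)\leq n(r-1)$.
   Context: A complete $(r+1)$-partite graph has its vertex set partitioned into $r+1$ nonempty independent sets with every two vertices in different parts adjacent. For a proper edge-coloring $\alpha$ of a graph $G$ (with positive integer colors) and a vertex $v$, let $S(v,\alpha)$ be the set of colors on edges incident to $v$, and $\mathrm{def}(v,\alpha)=\max S(v,\alpha)-\min S(v,\alpha)-|S(v,\alpha)|+1$. The deficiency of $G$ is $\mathrm{def}(G)=\min_\alpha \sum_{v\in V(G)}\mathrm{def}(v,\alpha)$ over all proper edge-colorings $\alpha$ of $G$; equivalently, the minimum number of pendant edges whose attachment to $G$ yields a graph admitting an interval coloring (a proper edge-coloring with colors $1,\ldots,t$, all used, in which every vertex's color set is an integer interval). *)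

theory Defs
  imports Complex_Main "HOL-Library.Disjoint_Sets" "HOL-Library.Multiset" "HOL-Library.Ramsey"
begin

(* A graph is given by its vertex set V and its set E of edges, each edge being a two-element
   subset of V. *)

definition finite_simple_graph :: "'a set \<Rightarrow> 'a set set \<Rightarrow> bool" where
  "finite_simple_graph V E \<longleftrightarrow> finite V \<and> E \<subseteq> nsets V 2"

definition complete_multipartite :: "'a set \<Rightarrow> 'a set set \<Rightarrow> 'a set set \<Rightarrow> bool" where
  "complete_multipartite V E P \<longleftrightarrow>
     finite_simple_graph V E \<and> partition_on V P \<and>
     (\<forall>X\<in>P. \<forall>u\<in>X. \<forall>v\<in>X. {u, v} \<notin> E) \<and>
     (\<forall>X\<in>P. \<forall>Y\<in>P. X \<noteq> Y \<longrightarrow> (\<forall>u\<in>X. \<forall>v\<in>Y. {u, v} \<in> E))"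

(* Only the values of the coloring on E matter. *)

definition proper_edge_coloring :: "'a set set \<Rightarrow> ('a set \<Rightarrow> nat) \<Rightarrow> bool" where
  "proper_edge_coloring E \<alpha> \<longleftrightarrow>
     (\<forall>e\<in>E. \<alpha> e > 0) \<and>
     (\<forall>e\<in>E. \<forall>f\<in>E. e \<noteq> f \<and> e \<inter> f \<noteq> {} \<longrightarrow> \<alpha> e \<noteq> \<alpha> f)"

definition color_set :: "'a set set \<Rightarrow> ('a set \<Rightarrow> nat) \<Rightarrow> 'a \<Rightarrow> nat set" where
  "color_set E \<alpha> v = \<alpha> ` {e \<in> E. v \<in> e}"

(* The natural subtractions never truncate on a finite nonempty color set, see
   of_nat_vertex_deficiency below.  An isolated vertex, where Max and Min are undefined, gets
   deficiency 0. *)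

definition vertex_deficiency :: "'a set set \<Rightarrow> ('a set \<Rightarrow> nat) \<Rightarrow> 'a \<Rightarrow> nat" where
  "vertex_deficiency E \<alpha> v =
     (let S = color_set E \<alpha> v in if S = {} then 0 else Max S - Min S + 1 - card S)"

(* The infimum is an attained minimum for finite graphs, see deficiency_attained below. *)

definition deficiency :: "'a set \<Rightarrow> 'a set set \<Rightarrow> nat" where
  "deficiency V E =
     (INF \<alpha>\<in>{\<alpha>. proper_edge_coloring E \<alpha>}. \<Sum>v\<in>V. vertex_deficiency E \<alpha> v)"

lemma of_nat_vertex_deficiency:
  assumes "finite (color_set E \<alpha> v)" "color_set E \<alpha> v \<noteq> {}"
  shows "int (vertex_deficiency E \<alpha> v) =
    int (Max (color_set E \<alpha> v)) - int (Min (color_set E \<alpha> v)) - int (card (color_set E \<alpha> v)) + 1"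
proof -
  let ?S = "color_set E \<alpha> v"
  have "?S \<subseteq> {Min ?S..Max ?S}"
    using assms by auto
  then have "card ?S \<le> card {Min ?S..Max ?S}"
    by (intro card_mono) auto
  moreover have "Min ?S \<le> Max ?S"
    using assms by (intro Max_ge Min_in)
  moreover have "vertex_deficiency E \<alpha> v = Max ?S - Min ?S + 1 - card ?S"
    using assms by (simp add: vertex_deficiency_def Let_def)
  ultimately show ?thesis
    unfolding card_atLeastAtMost by linarith
qed

lemma proper_edge_coloring_exists:
  assumes "finite_simple_graph V E"
  shows "\<exists>\<alpha>. proper_edge_coloring E \<alpha>"
proof -
  have "finite E"
    using assms finite_subset[OF _ finite_imp_finite_nsets]
    unfolding finite_simple_graph_def by auto
  then obtain f :: "'a set \<Rightarrow> nat" where "inj_on f E"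
    by (metis finite_imp_inj_to_nat_seg)
  then have "proper_edge_coloring E (\<lambda>e. Suc (f e))"
    by (auto simp: proper_edge_coloring_def inj_on_def)
  then show ?thesis by blast
qed

lemma deficiency_attained:
  assumes "finite_simple_graph V E"
  shows "\<exists>\<alpha>. proper_edge_coloring E \<alpha> \<and>
    deficiency V E = (\<Sum>v\<in>V. vertex_deficiency E \<alpha> v)"
proof -
  have "deficiency V E \<in>
      (\<lambda>\<alpha>. \<Sum>v\<in>V. vertex_deficiency E \<alpha> v) ` {\<alpha>. proper_edge_coloring E \<alpha>}"
    unfolding deficiency_def
    using proper_edge_coloring_exists[OF assms] by (intro Inf_nat_def1) auto
  then show ?thesis by auto
qed

lemma deficiency_le:
  "proper_edge_coloring E \<alpha> \<Longrightarrow> deficiency V E \<le> (\<Sum>v\<in>V. vertex_deficiency E \<alpha> v)"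
  unfolding deficiency_def by (intro cINF_lower) auto

end

theory Submission
  imports Defs "HOL-Combinatorics.Permutations"
begin

text \<open>The deficiency is in fact 0. It suffices to find a proper colouring in which the colours at each
  vertex lie in a window of as many consecutive integers as its degree.

  Let \<open>r = 2 m + 1\<close> with \<open>m \<ge> 2\<close> and put \<open>M = m n\<close>. Identify the union of the small parts with
  \<open>\<int>/2M\<close>, the parts being the residue classes modulo \<open>2 m\<close>. The classical even starter of \<open>\<int>/2M\<close> is
  a set of pairs realising every difference \<open>0 < d < M\<close> once; let its translate by \<open>k\<close> receive colour
  \<open>k\<close>. Drop the pairs whose difference is 1 or a multiple of \<open>m\<close>: at each vertex this frees exactly
  \<open>2 n + 2\<close> of the \<open>2 M\<close> colours, counting the two that a starter leaves free anyway, and they serve the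
  edges to the \<open>2 n + 2\<close> vertices of the big parts. Difference 1 gives an even cycle, coloured with two
  colours below; the edges between the classes \<open>a\<close> and \<open>a + m\<close> and those between the two big parts are
  coloured above. The cases \<open>m \<le> 1\<close> are settled by colouring with sums of indices.\<close>

section \<open>Isomorphism with a labelled model\<close>

lemma image_mset_eq_obtains_bij:
  assumes "finite A" "finite B" "image_mset f (mset_set A) = image_mset g (mset_set B)"
  obtains h where "bij_betw h A B" "\<And>x. x \<in> A \<Longrightarrow> f x = g (h x)"
proof -
  have "card A = card B"
    using arg_cong[OF assms(3), of size] by simp
  then obtain b where b: "bij_betw b A B"
    using finite_same_card_bij[OF assms(1,2)] by blast
  have "mset_set B = image_mset b (mset_set A)"
    using b image_mset_mset_set[of b A] by (simp add: bij_betw_def)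
  then have "image_mset f (mset_set A) = image_mset (g \<circ> b) (mset_set A)"
    using assms(3) by (simp add: multiset.map_comp)
  then obtain p where p: "p permutes A" "\<forall>x\<in>A. f x = (g \<circ> b) (p x)"
    using image_mset_eq_implies_permutes[OF assms(1)] by blast
  show thesis
    by (rule that[of "b \<circ> p"])
      (use p b bij_betw_trans[OF permutes_imp_bij[OF p(1)] b] in auto)
qed

text \<open>The part sizes determine the graph: \<open>h\<close> matches parts with fibres of
  \<open>\<pi>\<close> of equal size, and the bijections \<open>g X\<close> inside the matched pairs
  glue to \<open>f\<close>.\<close>

lemma complete_multipartite_labelling:
  fixes W :: "'b set" and \<pi> :: "'b \<Rightarrow> 'c"
  assumes G: "complete_multipartite V E P" and W: "finite W" and I: "finite I" "\<pi> ` W \<subseteq> I"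
    and sizes: "image_mset card (mset_set P) =
      image_mset (\<lambda>p. card {w \<in> W. \<pi> w = p}) (mset_set I)"
  obtains f where "bij_betw f V W"
    and "\<And>u v. u \<in> V \<Longrightarrow> v \<in> V \<Longrightarrow> {u, v} \<in> E \<longleftrightarrow> \<pi> (f u) \<noteq> \<pi> (f v)"
proof -
  have V: "finite V" and P: "partition_on V P"
    using G by (auto simp: complete_multipartite_def finite_simple_graph_def)
  have fP: "finite P"
    using finite_elements[OF V P] .
  have PV: "X \<subseteq> V" if "X \<in> P" for X
    using P that by (auto simp: partition_on_def)
  obtain h where h: "bij_betw h P I" "\<And>X. X \<in> P \<Longrightarrow> card X = card {w \<in> W. \<pi> w = h X}"
    using image_mset_eq_obtains_bij[OF fP I(1) sizes] by blast
  have "\<exists>g. bij_betw g X {w \<in> W. \<pi> w = h X}" if "X \<in> P" for X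
    using finite_same_card_bij[OF finite_subset[OF PV[OF that] V] _ h(2)[OF that]] W by simp
  then obtain g where g: "\<And>X. X \<in> P \<Longrightarrow> bij_betw (g X) X {w \<in> W. \<pi> w = h X}"
    by metis
  have "\<exists>X. X \<in> P \<and> v \<in> X" if "v \<in> V" for v
    using P that by (auto simp: partition_on_def)
  then obtain part where part: "\<And>v. v \<in> V \<Longrightarrow> part v \<in> P \<and> v \<in> part v"
    by metis
  have part_eq: "part v = X" if "X \<in> P" "v \<in> X" for v X
    using P part[of v] that PV[OF that(1)]
    unfolding partition_on_def disjoint_def by blast
  define f where "f v = g (part v) v" for v
  have f: "f v \<in> W" "\<pi> (f v) = h (part v)" if "v \<in> V" for v
    using bij_betw_apply[OF g, of "part v" v] part[OF that] by (auto simp: f_def)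
  have h_eq: "h X = h Y \<longleftrightarrow> X = Y" if "X \<in> P" "Y \<in> P" for X Y
    using h(1) that by (auto simp: bij_betw_def inj_on_def)
  have "inj_on f V"
  proof (rule inj_onI)
    fix u v assume uv: "u \<in> V" "v \<in> V" "f u = f v"
    then have "part u = part v"
      using f h_eq part by metis
    then show "u = v"
      using uv g[of "part u"] part[of u] part[of v]
      by (auto simp: f_def bij_betw_def inj_on_def)
  qed
  moreover have "f ` V = W"
  proof
    show "W \<subseteq> f ` V"
    proof
      fix w assume w: "w \<in> W"
      then have "\<pi> w \<in> h ` P"
        using h(1) I(2) by (auto simp: bij_betw_def)
      then obtain X where X: "X \<in> P" "\<pi> w = h X"
        by auto
      then have "w \<in> g X ` X"
        using g[OF X(1)] w by (auto simp: bij_betw_def)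
      then obtain v where v: "v \<in> X" "w = g X v"
        by auto
      then show "w \<in> f ` V"
        using part_eq[OF X(1) v(1)] PV[OF X(1)] by (auto simp: f_def)
    qed
  qed (use f in auto)
  moreover have "{u, v} \<in> E \<longleftrightarrow> \<pi> (f u) \<noteq> \<pi> (f v)" if "u \<in> V" "v \<in> V" for u v
  proof -
    have "{u, v} \<in> E \<longleftrightarrow> part u \<noteq> part v"
      using G part[OF that(1)] part[OF that(2)]
      unfolding complete_multipartite_def by metis
    then show ?thesis
      using f(2)[OF that(1)] f(2)[OF that(2)] h_eq part that by metis
  qed
  ultimately show thesis
    using that unfolding bij_betw_def by blast
qed

section \<open>Colourings whose windows are filled\<close>

text \<open>A set inside an interval of its own cardinality fills it, so at each vertex only an
  inclusion has to be checked.\<close>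

lemma vertex_deficiency_eq_0:
  assumes "color_set E \<alpha> v \<subseteq> {l..<l + card (color_set E \<alpha> v)}"
  shows "vertex_deficiency E \<alpha> v = 0"
proof (cases "color_set E \<alpha> v = {}")
  case True
  then show ?thesis
    by (simp add: vertex_deficiency_def)
next
  case False
  let ?S = "color_set E \<alpha> v"
  have "finite ?S"
    using assms finite_subset by blast
  then have "Max ?S \<in> ?S" "Min ?S \<in> ?S"
    using False by simp_all
  then have "Max ?S < l + card ?S" "l \<le> Min ?S" "Min ?S \<le> Max ?S"
    using assms \<open>finite ?S\<close> by (auto simp del: Min_in Max_in)
  then show ?thesis
    by (simp add: vertex_deficiency_def Let_def)
qed

text \<open>Moves the problem to ordered pairs of labels: symmetry makes \<open>c\<close> a function
  of edges, injectivity at each vertex makes it proper, and each window is as long as the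
  degree.\<close>

lemma deficiency_eq_0I:
  fixes W :: "'b set" and \<pi> :: "'b \<Rightarrow> 'c" and c :: "'b \<Rightarrow> 'b \<Rightarrow> nat" and l :: "'b \<Rightarrow> nat"
  assumes G: "complete_multipartite V E P" and W: "finite W" and I: "finite I" "\<pi> ` W \<subseteq> I"
    and sizes: "image_mset card (mset_set P) =
      image_mset (\<lambda>p. card {w \<in> W. \<pi> w = p}) (mset_set I)"
    and sym: "\<And>u w. u \<in> W \<Longrightarrow> w \<in> W \<Longrightarrow> \<pi> u \<noteq> \<pi> w \<Longrightarrow> c u w = c w u"
    and inj: "\<And>u. u \<in> W \<Longrightarrow> inj_on (c u) {w \<in> W. \<pi> w \<noteq> \<pi> u}"
    and pos: "\<And>u. u \<in> W \<Longrightarrow> 0 < l u"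
    and window: "\<And>u w. u \<in> W \<Longrightarrow> w \<in> W \<Longrightarrow> \<pi> w \<noteq> \<pi> u \<Longrightarrow>
      c u w \<in> {l u..<l u + card {w \<in> W. \<pi> w \<noteq> \<pi> u}}"
  shows "deficiency V E = 0"
proof -
  obtain f where f: "bij_betw f V W"
    and E: "\<And>u v. u \<in> V \<Longrightarrow> v \<in> V \<Longrightarrow> {u, v} \<in> E \<longleftrightarrow> \<pi> (f u) \<noteq> \<pi> (f v)"
    using complete_multipartite_labelling[OF G W I sizes] by blast
  have fW: "f v \<in> W" if "v \<in> V" for v
    using f that by (auto simp: bij_betw_def)
  have f_eq: "f u = f v \<longleftrightarrow> u = v" if "u \<in> V" "v \<in> V" for u v
    using f that by (auto simp: bij_betw_def inj_on_def)
  have E_ex: "\<exists>u v. u \<in> V \<and> v \<in> V \<and> e = {u, v}" if "e \<in> E" for e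
  proof -
    have "card e = 2" "e \<subseteq> V"
      using G that by (auto simp: complete_multipartite_def finite_simple_graph_def nsets_def)
    then show ?thesis
      by (auto simp: card_2_iff)
  qed
  then have EV: "\<exists>u. u \<in> V \<and> e = {v, u}" if "e \<in> E" "v \<in> e" for e v
    using that by blast
  have EV1: "v \<in> V" if "e \<in> E" "v \<in> e" for e v
    using E_ex[OF that(1)] that(2) by auto
  \<comment> \<open>An edge is an unordered pair, so one of its two orientations is chosen;
    \<open>sym\<close> makes the colour independent of the choice.\<close>
  define \<alpha> where "\<alpha> e = (SOME k. \<exists>u\<in>V. \<exists>v\<in>V. e = {u, v} \<and> k = c (f u) (f v))" for e
  have \<alpha>: "\<alpha> {u, v} = c (f u) (f v)" if "u \<in> V" "v \<in> V" "{u, v} \<in> E" for u v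
    unfolding \<alpha>_def
  proof (rule some1_equality)
    have "c (f v) (f u) = c (f u) (f v)"
      using sym[OF fW fW] E that by simp
    then show "\<exists>!k. \<exists>u'\<in>V. \<exists>v'\<in>V. {u, v} = {u', v'} \<and> k = c (f u') (f v')"
      using that by (metis doubleton_eq_iff)
  qed (use that in blast)
  have cols: "color_set E \<alpha> v = c (f v) ` {w \<in> W. \<pi> w \<noteq> \<pi> (f v)}" if v: "v \<in> V" for v
  proof
    show "color_set E \<alpha> v \<subseteq> c (f v) ` {w \<in> W. \<pi> w \<noteq> \<pi> (f v)}"
    proof
      fix k assume "k \<in> color_set E \<alpha> v"
      then obtain e where e: "e \<in> E" "v \<in> e" "k = \<alpha> e"
        by (auto simp: color_set_def)
      then obtain u where u: "u \<in> V" "e = {v, u}"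
        using EV by blast
      show "k \<in> c (f v) ` {w \<in> W. \<pi> w \<noteq> \<pi> (f v)}"
        by (rule image_eqI[of _ _ "f u"]) (use e u v \<alpha> E fW in auto)
    qed
    show "c (f v) ` {w \<in> W. \<pi> w \<noteq> \<pi> (f v)} \<subseteq> color_set E \<alpha> v"
    proof
      fix k assume "k \<in> c (f v) ` {w \<in> W. \<pi> w \<noteq> \<pi> (f v)}"
      then obtain u where u: "u \<in> V" "\<pi> (f u) \<noteq> \<pi> (f v)" "k = c (f v) (f u)"
        using f by (auto simp: bij_betw_def)
      show "k \<in> color_set E \<alpha> v"
        unfolding color_set_def
        by (rule image_eqI[of _ _ "{v, u}"]) (use u v \<alpha> E in auto)
    qed
  qed
  have "proper_edge_coloring E \<alpha>"
    unfolding proper_edge_coloring_def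
  proof (intro conjI ballI impI)
    fix e assume e: "e \<in> E"
    obtain u v where uv: "u \<in> V" "v \<in> V" "e = {u, v}"
      using E_ex[OF e] by blast
    show "0 < \<alpha> e"
      using e uv \<alpha>[of u v] window[OF fW fW, of u v] pos[OF fW, of u] E[of u v] by auto
  next
    fix e e' assume e: "e \<in> E" and e': "e' \<in> E" and ee: "e \<noteq> e' \<and> e \<inter> e' \<noteq> {}"
    then obtain v where v: "v \<in> e" "v \<in> e'"
      by blast
    obtain a where a: "a \<in> V" "e = {v, a}"
      using EV[OF e v(1)] by blast
    obtain b where b: "b \<in> V" "e' = {v, b}"
      using EV[OF e' v(2)] by blast
    have vV: "v \<in> V"
      using EV1 e v(1) .
    have "f a \<noteq> f b"
      using f_eq a b ee by auto
    then have "c (f v) (f a) \<noteq> c (f v) (f b)"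
      using inj_onD[OF inj[OF fW[OF vV]], of "f a" "f b"] a b e e' E vV fW by auto
    then show "\<alpha> e \<noteq> \<alpha> e'"
      using \<alpha> a b e e' vV by auto
  qed
  then have "deficiency V E \<le> (\<Sum>v\<in>V. vertex_deficiency E \<alpha> v)"
    by (rule deficiency_le)
  moreover have "vertex_deficiency E \<alpha> v = 0" if v: "v \<in> V" for v
    by (rule vertex_deficiency_eq_0[where l = "l (f v)"])
      (use window[OF fW[OF v]] in \<open>auto simp: cols[OF v] card_image[OF inj[OF fW[OF v]]]\<close>)
  ultimately show ?thesis
    by simp
qed

lemma almost_balanced_part_sizes:
  assumes "r > 0"
  shows "image_mset (\<lambda>p. if p < r - 1 then n else n + 1) (mset_set {..r}) =
    replicate_mset (r - 1) n + replicate_mset 2 (n + 1)"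
proof -
  have "{..r} = {..<r - 1} \<union> {r - 1, r}"
    using assms by auto
  then have "mset_set {..r} = mset_set {..<r - 1} + {#r - 1, r#}"
    using assms by (simp add: mset_set_Union)
  moreover have "image_mset (\<lambda>p. if p < r - 1 then n else n + 1) (mset_set {..<r - 1}) =
      image_mset (\<lambda>_. n) (mset_set {..<r - 1})"
    by (intro image_mset_cong) auto
  moreover have "\<not> r < r - 1"
    by simp
  ultimately show ?thesis
    using assms by (simp add: image_mset_const_eq numeral_2_eq_2)
qed

text \<open>The model has \<open>(r + 1) * n + 2\<close> vertices; removing the own part, of size
  \<open>n\<close> or \<open>n + 1\<close>, leaves the degrees \<open>r * n + 2\<close> and
  \<open>r * n + 1\<close>, which are the window lengths.\<close>

lemma almost_balanced_deficiency_eq_0I: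
  fixes n r :: nat and c :: "nat \<Rightarrow> nat \<Rightarrow> nat \<Rightarrow> nat \<Rightarrow> nat"
    and l :: "nat \<Rightarrow> nat \<Rightarrow> nat"
  defines "W \<equiv> SIGMA p:{..r}. {..<if p < r - 1 then n else n + 1}"
  assumes r: "r > 0" and G: "complete_multipartite V E P"
    and sizes: "image_mset card (mset_set P) = replicate_mset (r - 1) n + replicate_mset 2 (n + 1)"
    and sym: "\<And>p i q j. (p, i) \<in> W \<Longrightarrow> (q, j) \<in> W \<Longrightarrow> p \<noteq> q \<Longrightarrow> c p i q j = c q j p i"
    and inj: "\<And>p i q j q' j'. (p, i) \<in> W \<Longrightarrow> (q, j) \<in> W \<Longrightarrow> (q', j') \<in> W \<Longrightarrow> p \<noteq> q \<Longrightarrow> p \<noteq> q' \<Longrightarrow>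
      c p i q j = c p i q' j' \<Longrightarrow> q = q' \<and> j = j'"
    and pos: "\<And>p i. (p, i) \<in> W \<Longrightarrow> 0 < l p i"
    and window: "\<And>p i q j. (p, i) \<in> W \<Longrightarrow> (q, j) \<in> W \<Longrightarrow> p \<noteq> q \<Longrightarrow>
      c p i q j \<in> {l p i..<l p i + r * n + (if p < r - 1 then 2 else 1)}"
  shows "deficiency V E = 0"
proof (rule deficiency_eq_0I[OF G, where W = W and \<pi> = fst and I = "{..r}"
      and c = "\<lambda>(p, i) (q, j). c p i q j" and l = "\<lambda>(p, i). l p i"])
  define s where "s p = (if p < r - 1 then n else n + 1)" for p
  have part: "card {w \<in> W. fst w = p} = s p" if "p \<le> r" for p
  proof -
    have "{w \<in> W. fst w = p} = {p} \<times> {..<s p}"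
      using that by (auto simp: W_def s_def)
    then show ?thesis
      by (simp add: card_cartesian_product)
  qed
  show fW: "finite W"
    by (simp add: W_def)
  show "image_mset card (mset_set P) =
      image_mset (\<lambda>p. card {w \<in> W. fst w = p}) (mset_set {..r})"
    unfolding sizes almost_balanced_part_sizes[OF r, symmetric]
    by (intro image_mset_cong) (simp add: part s_def)
  have "card W = (\<Sum>p\<le>r. s p)"
    by (simp add: W_def s_def)
  also have "\<dots> = sum_mset (image_mset s (mset_set {..r}))"
    by (simp add: sum_unfold_sum_mset)
  also have "\<dots> = r * n + n + 2"
    using r unfolding s_def almost_balanced_part_sizes[OF r]
    by (cases r) (simp_all add: algebra_simps)
  finally have card_W: "card W = r * n + n + 2" .
  have deg: "card {w \<in> W. fst w \<noteq> p} = r * n + (if p < r - 1 then 2 else 1)" if "p \<le> r" for p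
  proof -
    have "{w \<in> W. fst w \<noteq> p} = W - {w \<in> W. fst w = p}"
      by auto
    then show ?thesis
      using fW card_W part[OF that] by (simp add: card_Diff_subset s_def)
  qed
  show "(case u of (p, i) \<Rightarrow> \<lambda>(q, j). c p i q j) w
      \<in> {(case u of (p, i) \<Rightarrow> l p i)..<(case u of (p, i) \<Rightarrow> l p i) + card {w \<in> W. fst w \<noteq> fst u}}"
    if "u \<in> W" "w \<in> W" "fst w \<noteq> fst u" for u w
  proof -
    obtain p i q j where uw: "u = (p, i)" "w = (q, j)"
      by (metis surj_pair)
    have "p \<le> r"
      using that uw by (simp add: W_def)
    then show ?thesis
      using window[of p i q j] that uw by (simp add: deg)
  qed
  show "inj_on (case u of (p, i) \<Rightarrow> \<lambda>(q, j). c p i q j) {w \<in> W. fst w \<noteq> fst u}" if "u \<in> W" for u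
  proof (rule inj_onI)
    fix w w' assume w: "w \<in> {w \<in> W. fst w \<noteq> fst u}" "w' \<in> {w \<in> W. fst w \<noteq> fst u}"
      "(case u of (p, i) \<Rightarrow> \<lambda>(q, j). c p i q j) w = (case u of (p, i) \<Rightarrow> \<lambda>(q, j). c p i q j) w'"
    obtain p i q j q' j' where uw: "u = (p, i)" "w = (q, j)" "w' = (q', j')"
      by (metis surj_pair)
    show "w = w'"
      using inj[of p i q j q' j'] that w uw by auto
  qed
qed (use sym pos in \<open>auto simp: W_def split: if_splits\<close>)

section \<open>Two parts and four parts\<close>

text \<open>Here both parts are big, and vertex \<open>i\<close> sees the colours from
  \<open>i + 1\<close> to \<open>i + n + 1\<close>.\<close>

lemma deficiency_bipartite:
  assumes "complete_multipartite V E P"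
    and "image_mset card (mset_set P) = replicate_mset 2 (n + 1)"
  shows "deficiency V E = 0"
  by (rule almost_balanced_deficiency_eq_0I[OF _ assms(1), where r = 1 and n = n
        and c = "\<lambda>p i q j. i + j + 1" and l = "\<lambda>p i. i + 1"])
    (use assms(2) in auto)

text \<open>Parts 0 and 1 are the small ones. The three perfect matchings of the set of parts occupy
  consecutive blocks of colours, and a vertex of index \<open>i\<close> has its window shifted by \<open>i\<close>.\<close>

definition four_partite_color :: "nat \<Rightarrow> nat \<Rightarrow> nat \<Rightarrow> nat \<Rightarrow> nat \<Rightarrow> nat" where
  "four_partite_color n p i q j = i + j +
     (if {p, q} = {0, 2} \<or> {p, q} = {1, 3} then 1
      else if {p, q} = {2, 3} then n + 1
      else if {p, q} = {0, 1} then n + 2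
      else 2 * n + 2)"

text \<open>After subtracting \<open>i\<close>, the blocks at a small part start at 1,
  \<open>n + 2\<close>, \<open>2 * n + 2\<close> and have sizes \<open>n + 1\<close>,
  \<open>n\<close>, \<open>n + 1\<close>; at a big part they start at 1, \<open>n + 1\<close>,
  \<open>2 * n + 2\<close> and have sizes \<open>n\<close>, \<open>n + 1\<close>, \<open>n\<close>.
  In both cases they abut.\<close>

lemma deficiency_four_partite:
  assumes "complete_multipartite V E P"
    and "image_mset card (mset_set P) = replicate_mset 2 n + replicate_mset 2 (n + 1)"
  shows "deficiency V E = 0"
proof (rule almost_balanced_deficiency_eq_0I[OF _ assms(1), where r = 3 and n = n
        and c = "four_partite_color n" and l = "\<lambda>p i. i + 1"])
  have four: "p = 0 \<or> p = 1 \<or> p = 2 \<or> p = 3" if "p \<le> 3" for p :: nat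
    using that by linarith
  let ?W = "SIGMA p:{..3::nat}. {..<if p < 3 - 1 then n else n + 1}"
  fix p i q j :: nat assume pq: "(p, i) \<in> ?W" "(q, j) \<in> ?W" "p \<noteq> q"
  show "four_partite_color n p i q j = four_partite_color n q j p i"
    by (simp add: four_partite_color_def insert_commute)
  show "four_partite_color n p i q j \<in> {i + 1..<i + 1 + 3 * n + (if p < 3 - 1 then 2 else 1)}"
    using pq four[of p] four[of q]
    by (auto simp: four_partite_color_def doubleton_eq_iff)
  fix q' j' assume q': "(q', j') \<in> ?W" "p \<noteq> q'"
    "four_partite_color n p i q j = four_partite_color n p i q' j'"
  show "q = q' \<and> j = j'"
    using pq q' four[of p] four[of q] four[of q']
    by (auto simp: four_partite_color_def doubleton_eq_iff)
qed (use assms(2) in auto)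

section \<open>Starter colours modulo 2M\<close>

text \<open>The colour of the starter edge \<open>{x, x + d}\<close> is \<open>x + starter_offset M d\<close>: the base pairs are
  \<open>{-e, e + 1}\<close> and \<open>{M - e, M + e}\<close>. The values at \<open>d = 0\<close> and \<open>d = M\<close> are the offsets that the starter
  leaves free.\<close>

definition starter_offset :: "int \<Rightarrow> int \<Rightarrow> int" where
  "starter_offset M d =
     d div 2 + (if even d then (if d < M then M else 0) else (if d > M then M else 0))"

lemma starter_offset_bounds:
  "0 \<le> d \<Longrightarrow> d < 2 * M \<Longrightarrow> 0 \<le> starter_offset M d \<and> starter_offset M d < 2 * M"
  unfolding starter_offset_def by (auto; presburger)

text \<open>Odd \<open>d <= M\<close>, even \<open>d >= M\<close>, even \<open>d < M\<close> and odd
  \<open>d > M\<close> take their values in the first, second, third and fourth quarter of the range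
  from 0 to \<open>2 M\<close>. Within a case the parity of \<open>d\<close> is fixed, so
  \<open>d div 2\<close> determines \<open>d\<close>.\<close>

lemma starter_offset_inj:
  assumes "0 \<le> d" "d < 2 * M" "0 \<le> d'" "d' < 2 * M"
    and "starter_offset M d = starter_offset M d'"
  shows "d = d'"
  using assms unfolding starter_offset_def by (auto split: if_splits; presburger)

text \<open>Modulo \<open>2 * M\<close> both alternatives say that the offsets differ by
  \<open>d\<close>, so an edge has the same colour read from either end. This fails at
  \<open>d = M\<close>, which is its own negative.\<close>

lemma starter_offset_sym:
  assumes "0 < d" "d < 2 * M" "d \<noteq> M"
  shows "starter_offset M d - starter_offset M (2 * M - d) = d \<or>
    starter_offset M d - starter_offset M (2 * M - d) = d - 2 * M"
  using assms unfolding starter_offset_def by (auto split: if_splits; presburger)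

lemma add_mod_cancel_int:
  fixes a x y N :: int
  assumes "(a + x) mod N = (a + y) mod N" "0 \<le> x" "x < N" "0 \<le> y" "y < N"
  shows "x = y"
proof -
  have "(a + x - a) mod N = (a + y - a) mod N"
    using assms(1) by (rule mod_diff_cong) simp
  then show ?thesis
    using assms by simp
qed

definition starter_color :: "int \<Rightarrow> int \<Rightarrow> int \<Rightarrow> nat" where
  "starter_color M x d = nat ((x + starter_offset M d) mod (2 * M))"

lemma starter_color_less: "0 < M \<Longrightarrow> starter_color M x d < nat (2 * M)"
  unfolding starter_color_def by (subst nat_less_eq_zless) auto

lemma starter_color_eq_iff:
  "0 < M \<Longrightarrow> starter_color M x d = starter_color M x' d' \<longleftrightarrow>
    (x + starter_offset M d) mod (2 * M) = (x' + starter_offset M d') mod (2 * M)"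
  by (simp add: starter_color_def nat_eq_iff)

lemma starter_color_inj_diff:
  assumes "starter_color M x d = starter_color M x d'"
    and "0 \<le> d" "d < 2 * M" "0 \<le> d'" "d' < 2 * M"
  shows "d = d'"
proof -
  have "(x + starter_offset M d) mod (2 * M) = (x + starter_offset M d') mod (2 * M)"
    using assms by (subst starter_color_eq_iff[symmetric]) auto
  then have "starter_offset M d = starter_offset M d'"
    by (rule add_mod_cancel_int) (use starter_offset_bounds assms(2-5) in auto)
  then show ?thesis
    using starter_offset_inj assms(2-5) by blast
qed

text \<open>Serves properness at a vertex of a big part: its label \<open>d\<close> is fixed while
  the small neighbour \<open>x\<close> varies.\<close>

lemma starter_color_inj_vertex:
  assumes "starter_color M x d = starter_color M x' d"
    and "0 \<le> x" "x < 2 * M" "0 \<le> x'" "x' < 2 * M"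
  shows "x = x'"
proof -
  have "(starter_offset M d + x) mod (2 * M) = (starter_offset M d + x') mod (2 * M)"
    using assms by (subst (1 2) add.commute, subst starter_color_eq_iff[symmetric]) auto
  then show ?thesis
    using assms(2-5) by (rule add_mod_cancel_int)
qed

lemma starter_color_sym:
  assumes "0 < d" "d < 2 * M" "d \<noteq> M" "(y - x) mod (2 * M) = d"
  shows "starter_color M x d = starter_color M y (2 * M - d)"
proof -
  let ?a = "starter_offset M d" and ?b = "starter_offset M (2 * M - d)"
  have "2 * M dvd (y - x) - d"
    using assms(4) by (metis dvd_minus_mod)
  moreover have "2 * M dvd d - (?a - ?b)"
    using starter_offset_sym[OF assms(1-3)] by (elim disjE) simp_all
  ultimately have "2 * M dvd ((y - x) - d) + (d - (?a - ?b))"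
    by (rule dvd_add)
  then have "2 * M dvd (y + ?b) - (x + ?a)"
    by (simp add: algebra_simps)
  then have "(y + ?b) mod (2 * M) = (x + ?a) mod (2 * M)"
    by (simp add: mod_eq_dvd_iff)
  then show ?thesis
    using assms by (simp add: starter_color_def)
qed

section \<open>At least six parts: labels and the circulant colouring\<close>

text \<open>For a small part (\<open>p < 2 m\<close>) this is the element of \<open>\<int>/2M\<close> representing the vertex. The vertices
  of the two big parts are labelled bijectively by the dropped differences, namely the multiples of \<open>m\<close>
  and \<open>\<plusminus>1\<close>.\<close>

definition position :: "nat \<Rightarrow> nat \<Rightarrow> nat \<Rightarrow> nat \<Rightarrow> int" where
  "position m n p i =
     (if p < 2 * m then int p + 2 * int m * int i
      else if i < n then int m * (2 * int i + int p - 2 * int m)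
      else if p = 2 * m then 1 else 2 * int (m * n) - 1)"

lemma position_bounds:
  assumes "m > 0" "n > 0" "p \<le> 2 * m + 1" "i < (if p < 2 * m then n else n + 1)"
  shows "0 \<le> position m n p i" "position m n p i < 2 * int (m * n)"
proof -
  have mn: "0 < int (m * n)"
    using assms by simp
  consider "p < 2 * m" "i < n" | "\<not> p < 2 * m" "i < n" | "\<not> p < 2 * m" "i = n"
    using assms(4) by (auto simp: less_Suc_eq split: if_splits)
  then have "0 \<le> position m n p i \<and> position m n p i < 2 * int (m * n)"
  proof cases
    case 1
    then have "2 * int m * (int i + 1) \<le> 2 * int m * int n"
      by (intro mult_left_mono) auto
    then show ?thesis
      using 1 by (simp add: position_def algebra_simps)
  next
    case 2
    then have "int m * (2 * int i + int p - 2 * int m) \<le> int m * (2 * int n - 1)"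
      using assms(3) by (intro mult_left_mono) auto
    moreover have "0 \<le> int m * (2 * int i + int p - 2 * int m)"
      using 2 by (intro mult_nonneg_nonneg) auto
    moreover have "int m * (2 * int n - 1) < 2 * int (m * n)"
      using assms(1) by (simp add: algebra_simps)
    ultimately show ?thesis
      using 2 by (simp add: position_def)
  next
    case 3
    then show ?thesis
      using mn by (simp add: position_def)
  qed
  then show "0 \<le> position m n p i" "position m n p i < 2 * int (m * n)"
    by auto
qed

lemma position_small_inj:
  assumes "position m n p i = position m n q j" "p < 2 * m" "q < 2 * m"
  shows "p = q \<and> i = j"
proof -
  have "int (p + 2 * m * i) = int (q + 2 * m * j)"
    using assms by (simp add: position_def)
  then have eq: "p + 2 * m * i = q + 2 * m * j"
    by (simp only: of_nat_eq_iff)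
  have "p = q"
    using arg_cong[OF eq, of "\<lambda>x. x mod (2 * m)"] assms by simp
  then show ?thesis
    using eq assms by simp
qed

lemma position_big_cases:
  assumes "p = 2 * m \<or> p = 2 * m + 1" "i \<le> n"
  shows "int m dvd position m n p i \<or> position m n p i = 1 \<or>
    position m n p i = 2 * int (m * n) - 1"
  using assms by (auto simp: position_def)

text \<open>As \<open>m >= 2\<close>, the labels 1 and \<open>2 M - 1\<close> are not multiples of
  \<open>m\<close>, so the label shows whether \<open>i = n\<close>; they differ because
  \<open>M >= 2\<close>. For a multiple of \<open>m\<close>, the parity of the quotient gives the
  part.\<close>

lemma position_big_inj:
  assumes m: "m \<ge> 2" and n: "n > 0" and eq: "position m n p i = position m n q j"
    and p: "p = 2 * m \<or> p = 2 * m + 1" "i \<le> n" and q: "q = 2 * m \<or> q = 2 * m + 1" "j \<le> n"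
  shows "p = q \<and> i = j"
proof -
  have mult: "i < n \<longleftrightarrow> int m dvd position m n p i"
    if "p = 2 * m \<or> p = 2 * m + 1" "i \<le> n" for p i
  proof -
    have "\<not> int m dvd 1"
      using m by simp
    moreover have "\<not> int m dvd 2 * int (m * n) - 1"
    proof
      assume "int m dvd 2 * int (m * n) - 1"
      then have "int m dvd 2 * int (m * n) - (2 * int (m * n) - 1)"
        by (rule dvd_diff[rotated]) simp
      moreover have "2 * int (m * n) - (2 * int (m * n) - 1) = 1"
        by simp
      ultimately show False
        using \<open>\<not> int m dvd 1\<close> by metis
    qed
    ultimately show ?thesis
      using that by (auto simp: position_def)
  qed
  show ?thesis
  proof (cases "i < n")
    case True
    then have "j < n"
      using mult[OF p] mult[OF q] eq by simp
    then have "int m * (2 * int i + int p - 2 * int m) = int m * (2 * int j + int q - 2 * int m)"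
      using True eq p q by (auto simp: position_def)
    then have "2 * int i + int p = 2 * int j + int q"
      using m by simp
    then show ?thesis
      using p q by presburger
  next
    case False
    then have "i = n" "j = n"
      using mult[OF p] mult[OF q] eq p q by auto
    moreover have "2 * 1 \<le> int (m * n)"
      using m n mult_le_mono[of 2 m 1 n] by linarith
    ultimately show ?thesis
      using eq p q by (auto simp: position_def)
  qed
qed

text \<open>Differences 1 and \<open>2 M - 1\<close> are one cycle edge seen from its two ends; its
  colour is the parity of the end from which the difference is 1, read off the part since
  \<open>2 * m\<close> is even. An edge from a small vertex \<open>x\<close> to the big vertex
  labelled \<open>y\<close> gets the colour that the dropped difference \<open>y\<close> would have
  at \<open>x\<close>.\<close>

definition circulant_color :: "nat \<Rightarrow> nat \<Rightarrow> nat \<Rightarrow> nat \<Rightarrow> nat \<Rightarrow> nat \<Rightarrow> nat" where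
  "circulant_color m n p i q j =
     (let M = int (m * n); x = position m n p i; y = position m n q j; d = (y - x) mod (2 * M) in
      if p < 2 * m \<and> q < 2 * m then
        if d = 1 then 1 + p mod 2
        else if d = 2 * M - 1 then 1 + q mod 2
        else if int m dvd d then 2 * m * n + 3 + (i + j) mod n
        else 3 + starter_color M x d
      else if p < 2 * m then 3 + starter_color M x y
      else if q < 2 * m then 3 + starter_color M y x
      else 2 * m * n + 3 + (i + j) mod (n + 1))"

text \<open>A position in a small part is congruent to its part modulo \<open>2 * m\<close>, which
  divides \<open>2 M\<close>; hence parity and divisibility by \<open>m\<close> of a difference
  depend on the parts alone.\<close>

lemma small_difference:
  assumes "m > 0" "n > 0" and pq: "p < 2 * m" "q < 2 * m" "p \<noteq> q" and ij: "i < n" "j < n"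
  defines "d \<equiv> (position m n q j - position m n p i) mod (2 * int (m * n))"
  shows "0 < d" "d < 2 * int (m * n)"
    and "(position m n p i - position m n q j) mod (2 * int (m * n)) = 2 * int (m * n) - d"
    and "int m dvd d \<longleftrightarrow> int m dvd int q - int p"
    and "even d \<longleftrightarrow> even (p + q)"
proof -
  let ?x = "position m n p i" and ?y = "position m n q j" and ?Q = "2 * int (m * n)"
  have Q: "0 < ?Q"
    using assms by simp
  have b: "0 \<le> ?x" "?x < ?Q" "0 \<le> ?y" "?y < ?Q"
    using position_bounds[of m n p i] position_bounds[of m n q j] assms by auto
  have "?x \<noteq> ?y"
    using position_small_inj[of m n p i q j] pq by auto
  have "d \<noteq> 0"
  proof
    assume "d = 0"
    then have "?y mod ?Q = ?x mod ?Q"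
      by (simp add: d_def mod_eq_dvd_iff mod_eq_0_iff_dvd)
    with b \<open>?x \<noteq> ?y\<close> show False
      by simp
  qed
  moreover have "0 \<le> d"
    using Q by (simp add: d_def)
  ultimately show "0 < d"
    by simp
  show "d < ?Q"
    using Q by (simp add: d_def)
  show "(?x - ?y) mod ?Q = ?Q - d"
    using zmod_zminus1_eq_if[of "?y - ?x" ?Q] \<open>d \<noteq> 0\<close>
    unfolding d_def minus_diff_eq by (simp only: if_False)
  have diff: "?y - ?x = int q - int p + 2 * (int m * (int j - int i))"
    using pq by (simp add: position_def algebra_simps)
  have "int m dvd d \<longleftrightarrow> int m dvd ?y - ?x"
    unfolding d_def by (rule dvd_mod_iff) simp
  also have "\<dots> \<longleftrightarrow> int m dvd int q - int p"
    unfolding diff by (rule dvd_add_left_iff) simp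
  finally show "int m dvd d \<longleftrightarrow> int m dvd int q - int p" .
  have "even d \<longleftrightarrow> even (?y - ?x)"
    unfolding d_def by (rule dvd_mod_iff) simp
  also have "\<dots> \<longleftrightarrow> even (p + q)"
    unfolding diff by auto
  finally show "even d \<longleftrightarrow> even (p + q)" .
qed

section \<open>Symmetry, windows and properness of the circulant colouring\<close>

lemma circulant_color_sym:
  assumes "m \<ge> 2" "n > 0" "p \<noteq> q"
    and "i < (if p < 2 * m then n else n + 1)" "j < (if q < 2 * m then n else n + 1)"
  shows "circulant_color m n p i q j = circulant_color m n q j p i"
proof (cases "p < 2 * m \<and> q < 2 * m")
  case True
  let ?M = "int (m * n)"
  define x y where "x = position m n p i" and "y = position m n q j"
  define d where "d = (y - x) mod (2 * ?M)"
  have d: "0 < d" "d < 2 * ?M" "(x - y) mod (2 * ?M) = 2 * ?M - d"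
    using small_difference(1-3)[of m n p q i j] True assms by (simp_all add: d_def x_def y_def)
  \<comment> \<open>\<open>M >= 2\<close> separates the differences 1 and \<open>2 M - 1\<close>,
    which swapping the ends interchanges.\<close>
  have "2 * 1 \<le> m * n"
    using assms by (intro mult_le_mono) auto
  then have M: "2 \<le> ?M"
    by linarith
  have "int m dvd 2 * ?M - d \<longleftrightarrow> int m dvd d"
    by (rule dvd_diff_right_iff) simp
  \<comment> \<open>\<open>M\<close> is a multiple of \<open>m\<close>, so the asymmetric difference
    \<open>d = M\<close> cannot occur here.\<close>
  moreover have "starter_color ?M x d = starter_color ?M y (2 * ?M - d)" if "\<not> int m dvd d"
    using that d by (intro starter_color_sym) (auto simp: d_def)
  ultimately show ?thesis
    using True M d
    by (simp add: circulant_color_def Let_def x_def[symmetric] y_def[symmetric]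
        d_def[symmetric] add.commute del: of_nat_mult)
next
  case False
  then show ?thesis
    by (auto simp: circulant_color_def Let_def add.commute)
qed

text \<open>Big parts meet no cycle edge, so their windows start at 3. The top block has
  \<open>n\<close> colours at a small part and \<open>n + 1\<close> at a big one.\<close>

lemma circulant_color_window:
  assumes "m \<ge> 2" "n > 0" "p \<noteq> q"
    and "i < (if p < 2 * m then n else n + 1)" "j < (if q < 2 * m then n else n + 1)"
  defines "k \<equiv> circulant_color m n p i q j"
  shows "(if p < 2 * m then 1 else 3) \<le> k" "k < 2 * m * n + n + (if p < 2 * m then 3 else 4)"
proof -
  have "0 < int (m * n)"
    using assms by simp
  then have "starter_color (int (m * n)) x d < 2 * m * n" for x d
    using starter_color_less[of "int (m * n)" x d] by (simp add: nat_mult_distrib)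
  note less = trans_less_add1[OF this, of _ _ n]
  have "(i + j) mod n < n" "(i + j) mod (n + 1) < n + 1"
    using assms by simp_all
  then show "(if p < 2 * m then 1 else 3) \<le> k" "k < 2 * m * n + n + (if p < 2 * m then 3 else 4)"
    using less[of "position m n p i"] less[of "position m n q j"]
      mod_less_divisor[of 2 p] mod_less_divisor[of 2 q] assms(2)
    by (auto simp: k_def circulant_color_def Let_def intro: less_SucI)
qed

lemma nonzero_multiple_abs_less:
  fixes a m :: int
  assumes "m dvd a" "a \<noteq> 0" "\<bar>a\<bar> < 2 * m"
  shows "a = m \<or> a = - m"
proof -
  obtain k where k: "a = m * k"
    using assms(1) by (elim dvdE)
  have "0 < m"
    using assms(3) by linarith
  then have "m * \<bar>k\<bar> < m * 2"
    using assms(3) k by (simp add: abs_mult mult.commute)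
  then have "\<bar>k\<bar> < 2"
    using \<open>0 < m\<close> by (simp add: mult_less_cancel_left_pos)
  then show ?thesis
    using assms(2) k by (cases "k = 1"; cases "k = -1"; cases "k = 0") auto
qed

text \<open>The range of a colour tells the kind of edge, and for each kind the neighbour is
  recovered separately.\<close>

lemma circulant_color_inj_small:
  assumes m: "m \<ge> 2" and n: "n > 0" and p: "p < 2 * m" "i < n"
    and q: "q \<le> 2 * m + 1" "j < (if q < 2 * m then n else n + 1)"
    and q': "q' \<le> 2 * m + 1" "j' < (if q' < 2 * m then n else n + 1)"
    and ne: "p \<noteq> q" "p \<noteq> q'" and eq: "circulant_color m n p i q j = circulant_color m n p i q' j'"
  shows "q = q' \<and> j = j'"
proof -
  let ?M = "int (m * n)"
  have "2 * 1 \<le> m * n"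
    using m n by (intro mult_le_mono) auto
  then have M: "2 \<le> ?M" "0 < ?M"
    by linarith+
  define x where "x = position m n p i"
  \<comment> \<open>The true difference for a small neighbour, the label for a big one: all colours
    of the starter block then have the form \<open>starter_color ?M x (D q j)\<close>.\<close>
  define D where "D q j = (if q < 2 * m then (position m n q j - x) mod (2 * ?M)
    else position m n q j)" for q j
  have D_bounds: "0 \<le> D q j" "D q j < 2 * ?M"
    if "q \<le> 2 * m + 1" "j < (if q < 2 * m then n else n + 1)" for q j
    using position_bounds[OF _ n that] m M by (simp_all add: D_def)
  have special: "int m dvd D q j \<or> D q j = 1 \<or> D q j = 2 * ?M - 1"
    if "q \<le> 2 * m + 1" "j < (if q < 2 * m then n else n + 1)" "\<not> q < 2 * m" for q j
  proof -
    have "q = 2 * m \<or> q = 2 * m + 1" "j \<le> n"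
      using that by auto
    from position_big_cases[OF this] that(3) show ?thesis
      by (simp add: D_def)
  qed
  have star: "starter_color ?M x d < 2 * m * n" for d
    using starter_color_less[OF M(2), of x d] by (simp add: nat_mult_distrib)
  have color: "circulant_color m n p i q j =
     (if q < 2 * m \<and> D q j = 1 then 1 + p mod 2
      else if q < 2 * m \<and> D q j = 2 * ?M - 1 then 1 + q mod 2
      else if q < 2 * m \<and> int m dvd D q j then 2 * m * n + 3 + (i + j) mod n
      else 3 + starter_color ?M x (D q j))" for q j
    using p by (simp add: circulant_color_def Let_def x_def[symmetric] D_def)
  have parity: "even (D q j) \<longleftrightarrow> even (p + q)"
    if "q < 2 * m" "j < n" "p \<noteq> q" for q j
    using small_difference(5)[of m n p q i j] that m n p by (simp add: D_def x_def)
  have dvd: "int m dvd D q j \<longleftrightarrow> int m dvd int q - int p"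
    if "q < 2 * m" "j < n" "p \<noteq> q" for q j
    using small_difference(4)[of m n p q i j] that m n p by (simp add: D_def x_def)
  have D_inj: "q = q' \<and> j = j'"
    if "D q j = D q' j'" "q < 2 * m \<longleftrightarrow> q' < 2 * m"
  proof (cases "q < 2 * m")
    case True
    then have "(- x + position m n q j) mod (2 * ?M) = (- x + position m n q' j') mod (2 * ?M)"
      using that by (simp add: D_def)
    moreover have "0 < m"
      using m by simp
    note position_bounds[OF this n q] position_bounds[OF this n q']
    ultimately have "position m n q j = position m n q' j'"
      by (rule add_mod_cancel_int)
    then show ?thesis
      using position_small_inj True that by blast
  next
    case False
    then have "position m n q j = position m n q' j'"
      using that by (simp add: D_def)
    moreover have "q = 2 * m \<or> q = 2 * m + 1" "j \<le> n" "q' = 2 * m \<or> q' = 2 * m + 1" "j' \<le> n"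
      using False that q q' by auto
    ultimately show ?thesis
      by (rule position_big_inj[OF m n])
  qed
  have odds: "odd (2 * ?M - 1)"
    by simp
  have near: "q < 2 * m \<and> (D q j = 1 \<or> D q j = 2 * ?M - 1)"
    if "circulant_color m n p i q j < 3" for q j
    using that unfolding color by (simp split: if_split_asm)
  have parallel: "q < 2 * m \<and> int m dvd D q j"
    if "\<not> circulant_color m n p i q j < 2 * m * n + 3" for q j
    using that star[of "D q j"] mod_less_divisor[of 2 p] mod_less_divisor[of 2 q]
    unfolding color by (simp split: if_split_asm)
  let ?c = "circulant_color m n p i q j"
  consider "?c < 3" | "\<not> ?c < 2 * m * n + 3" | "3 \<le> ?c" "?c < 2 * m * n + 3"
    by linarith
  then show ?thesis
  proof cases
    case 1
    have small: "q < 2 * m" "q' < 2 * m"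
      and D: "D q j = 1 \<or> D q j = 2 * ?M - 1" "D q' j' = 1 \<or> D q' j' = 2 * ?M - 1"
      using near[of q j] near[of q' j'] 1 eq by auto
    have "j < n" "j' < n"
      using small q q' by auto
    \<comment> \<open>Cycle neighbours lie in parts of the other parity, so the edges of difference
      1 and \<open>2 M - 1\<close>, coloured by the parity of \<open>p\<close> and of the
      neighbour's part, differ in colour.\<close>
    then have "odd (p + q)" "odd (p + q')"
      using parity[of q j] parity[of q' j'] small D odds ne by auto
    then have "p mod 2 \<noteq> q mod 2" "p mod 2 \<noteq> q' mod 2"
      by presburger+
    then have "D q j = D q' j'"
      using eq D small unfolding color by (simp split: if_split_asm)
    then show ?thesis
      using D_inj small by blast
  next
    case 2
    have small: "q < 2 * m" "q' < 2 * m" and D: "int m dvd D q j" "int m dvd D q' j'"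
      using parallel[of q j] parallel[of q' j'] 2 eq by auto
    have j: "j < n" "j' < n"
      using small q q' by auto
    have "int m dvd int q - int p" "int m dvd int q' - int p"
      using dvd small D j ne by auto
    then have "int q - int p = int m \<or> int q - int p = - int m"
      "int q' - int p = int m \<or> int q' - int p = - int m"
      using nonzero_multiple_abs_less[of "int m"] small p ne by auto
    \<comment> \<open>Only one of \<open>p + m\<close> and \<open>p - m\<close> is the index of a
      small part.\<close>
    then have "q = q'"
      using small p by auto
    moreover have "(int i + int j) mod int n = (int i + int j') mod int n"
    proof -
      have "?c \<ge> 2 * m * n + 3" "circulant_color m n p i q' j' \<ge> 2 * m * n + 3"
        using 2 eq by auto
      then have "(i + j) mod n = (i + j') mod n"
        using eq small D mod_less_divisor[of 2 p] mod_less_divisor[of 2 q] mod_less_divisor[of 2 q']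
        unfolding color by (simp split: if_split_asm)
      then show ?thesis
        by (metis of_nat_add of_nat_mod)
    qed
    then have "int j = int j'"
      by (rule add_mod_cancel_int) (use j in auto)
    ultimately show ?thesis
      by simp
  next
    case 3
    have gen: "\<not> (q < 2 * m \<and> (D q j = 1 \<or> D q j = 2 * ?M - 1 \<or> int m dvd D q j)) \<and>
        circulant_color m n p i q j = 3 + starter_color ?M x (D q j)"
      if "3 \<le> circulant_color m n p i q j" "circulant_color m n p i q j < 2 * m * n + 3" for q j
      using that mod_less_divisor[of 2 p] mod_less_divisor[of 2 q]
      unfolding color by (simp split: if_split_asm)
    have "starter_color ?M x (D q j) = starter_color ?M x (D q' j')"
      using gen[of q j] gen[of q' j'] 3 eq by auto
    then have D: "D q j = D q' j'"
      using D_bounds[OF q] D_bounds[OF q'] by (rule starter_color_inj_diff)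
    \<comment> \<open>A big neighbour has a dropped difference as its label, and no small neighbour
      with a colour in this block has such a difference.\<close>
    moreover have "q < 2 * m \<longleftrightarrow> q' < 2 * m"
      using gen[of q j] gen[of q' j'] 3 eq special[OF q] special[OF q'] D by metis
    ultimately show ?thesis
      using D_inj by blast
  qed
qed

text \<open>Seen from a big part, the starter colours are translates of one offset by the positions
  of the small neighbours; the \<open>n + 1\<close> vertices of the other big part get distinct
  residues modulo \<open>n + 1\<close>.\<close>

lemma circulant_color_inj_big:
  assumes m: "m \<ge> 2" and n: "n > 0" and p: "\<not> p < 2 * m" "p \<le> 2 * m + 1"
    and q: "q \<le> 2 * m + 1" "j < (if q < 2 * m then n else n + 1)"
    and q': "q' \<le> 2 * m + 1" "j' < (if q' < 2 * m then n else n + 1)"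
    and ne: "p \<noteq> q" "p \<noteq> q'" and eq: "circulant_color m n p i q j = circulant_color m n p i q' j'"
  shows "q = q' \<and> j = j'"
proof -
  let ?M = "int (m * n)"
  define x where "x = position m n p i"
  have "0 < ?M"
    using m n by simp
  then have star: "starter_color ?M y x < 2 * m * n" for y
    using starter_color_less[of ?M y x] by (simp add: nat_mult_distrib)
  have color: "circulant_color m n p i q j =
      (if q < 2 * m then 3 + starter_color ?M (position m n q j) x
       else 2 * m * n + 3 + (i + j) mod (n + 1))" for q j
    using p by (simp add: circulant_color_def Let_def x_def)
  have side: "q < 2 * m \<longleftrightarrow> circulant_color m n p i q j < 2 * m * n + 3" for q j
    using star[of "position m n q j"] unfolding color by simp
  have same: "q < 2 * m \<longleftrightarrow> q' < 2 * m"
    using side[of q j] side[of q' j'] eq by simp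
  show ?thesis
  proof (cases "q < 2 * m")
    case True
    then have "starter_color ?M (position m n q j) x = starter_color ?M (position m n q' j') x"
      using eq same unfolding color by simp
    moreover have "0 < m"
      using m by simp
    note position_bounds[OF this n q] position_bounds[OF this n q']
    ultimately have "position m n q j = position m n q' j'"
      by (rule starter_color_inj_vertex)
    then show ?thesis
      using position_small_inj True same by blast
  next
    case False
    then have "(i + j) mod (n + 1) = (i + j') mod (n + 1)"
      using eq same unfolding color by simp
    then have "(int i + int j) mod int (n + 1) = (int i + int j') mod int (n + 1)"
      by (metis of_nat_add of_nat_mod)
    then have "int j = int j'"
      by (rule add_mod_cancel_int) (use q q' False same in auto)
    moreover have "q = q'"
      using False same p q q' ne by linarith
    ultimately show ?thesis
      by simp
  qed
qed

lemma deficiency_circulant: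
  assumes m: "m \<ge> 2" and n: "n > 0" and G: "complete_multipartite V E P"
    and "image_mset card (mset_set P) = replicate_mset (2 * m) n + replicate_mset 2 (n + 1)"
  shows "deficiency V E = 0"
proof (rule almost_balanced_deficiency_eq_0I[OF _ G, where r = "2 * m + 1" and n = n
      and c = "circulant_color m n" and l = "\<lambda>p i. if p < 2 * m then 1 else 3"])
  let ?W = "SIGMA p:{..2 * m + 1}. {..<if p < 2 * m + 1 - 1 then n else n + 1}"
  fix p i q j assume "(p, i) \<in> ?W" "(q, j) \<in> ?W" and pq: "p \<noteq> q"
  then have p: "p \<le> 2 * m + 1" "i < (if p < 2 * m then n else n + 1)"
    and q: "q \<le> 2 * m + 1" "j < (if q < 2 * m then n else n + 1)"
    by simp_all
  show "circulant_color m n p i q j = circulant_color m n q j p i"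
    using circulant_color_sym[OF m n pq p(2) q(2)] .
  show "circulant_color m n p i q j \<in> {if p < 2 * m then 1 else 3..<
      (if p < 2 * m then 1 else 3) + (2 * m + 1) * n + (if p < 2 * m + 1 - 1 then 2 else 1)}"
    using circulant_color_window[OF m n pq p(2) q(2)] by (simp add: algebra_simps split: if_splits)
  fix q' j' assume "(q', j') \<in> ?W" and pq': "p \<noteq> q'"
    and eq: "circulant_color m n p i q j = circulant_color m n p i q' j'"
  then have q': "q' \<le> 2 * m + 1" "j' < (if q' < 2 * m then n else n + 1)"
    by simp_all
  show "q = q' \<and> j = j'"
  proof (cases "p < 2 * m")
    case True
    then have "i < n"
      using p by simp
    from circulant_color_inj_small[OF m n True this q q' pq pq' eq] show ?thesis .
  next
    case False
    from circulant_color_inj_big[OF m n this p(1) q q' pq pq' eq] show ?thesis .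
  qed
qed (use assms(4) in auto)

theorem theorem12:
  fixes n r :: nat and V :: "'a set" and E P :: "'a set set"
  assumes "n > 0" and "r > 0" and "odd r"
    and "complete_multipartite V E P"
    and "image_mset card (mset_set P) = replicate_mset (r - 1) n + replicate_mset 2 (n + 1)"
  shows "deficiency V E \<le> n * (r - 1)"
proof -
  obtain m where r: "r = 2 * m + 1"
    using assms(3) by (elim oddE)
  consider "m = 0" | "m = 1" | "m \<ge> 2"
    by linarith
  then have "deficiency V E = 0"
  proof cases
    case 1
    then show ?thesis
      using deficiency_bipartite[OF assms(4)] assms(5) r by simp
  next
    case 2
    then show ?thesis
      using deficiency_four_partite[OF assms(4)] assms(5) r by simp
  next
    case 3
    then show ?thesis
      using deficiency_circulant[OF _ assms(1,4)] assms(5) r by simp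
  qed
  then show ?thesis
    by simp
qed

end
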